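(* Let $X$ be an indecomposable continuum. Then every point $p\in X$ is a proper shore point of $X$.
   Context: A continuum is a nondegenerate (more than one point) compact connected Hausdorff space, not necessarily metrizable. A subcontinuum of $X$ is a nonempty compact connected subset (singletons allowed). $X$ is indecomposable if it is not the union of two proper subcontinua. The composant $\kappa(p)$ of $p\in X$ is the union of all proper subcontinua of $X$ that contain $p$. A point $p\in X$ is a proper shore point if for every finite collection of nonempty open sets $U_1,\dots,U_N\subset X$ some subcontinuum $K\subset \kappa(p)\setminus\{p\}$ meets each $U_n$. *)

theory Defs
  imports "HOL-Analysis.Analysis"
begin

definition continuum :: "'a topology \<Rightarrow> bool" where
  "continuum X \<longleftrightarrow>
     compact_space X \<and> connected_space X \<and> Hausdorff_space X \<and>
     (\<exists>x\<in>topspace X. \<exists>y\<in>topspace X. x \<noteq> y)"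

text \<open>Singletons count as subcontinua; since \<^const>\<open>connectedin\<close> holds of the empty set,
  nonemptiness is required explicitly.\<close>

definition subcontinuum :: "'a topology \<Rightarrow> 'a set \<Rightarrow> bool" where
  "subcontinuum X K \<longleftrightarrow> K \<noteq> {} \<and> compactin X K \<and> connectedin X K"

definition proper_subcontinuum :: "'a topology \<Rightarrow> 'a set \<Rightarrow> bool" where
  "proper_subcontinuum X K \<longleftrightarrow> subcontinuum X K \<and> K \<noteq> topspace X"

definition indecomposable :: "'a topology \<Rightarrow> bool" where
  "indecomposable X \<longleftrightarrow>
     (\<nexists>A B. proper_subcontinuum X A \<and> proper_subcontinuum X B \<and> A \<union> B = topspace X)"

definition composant :: "'a topology \<Rightarrow> 'a \<Rightarrow> 'a set" where
  "composant X p = \<Union>{K. proper_subcontinuum X K \<and> p \<in> K}"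

definition proper_shore_point :: "'a topology \<Rightarrow> 'a \<Rightarrow> bool" where
  "proper_shore_point X p \<longleftrightarrow>
     p \<in> topspace X \<and>
     (\<forall>\<U>. finite \<U> \<and> (\<forall>U\<in>\<U>. openin X U \<and> U \<noteq> {}) \<longrightarrow>
        (\<exists>K. subcontinuum X K \<and> K \<subseteq> composant X p - {p} \<and> (\<forall>U\<in>\<U>. K \<inter> U \<noteq> {})))"

end

theory Submission
  imports Defs
begin

text \<open>Fix \<open>p\<close> and nonempty open sets \<open>U\<^sub>1, \<dots>, U\<^sub>N\<close>. For \<open>x \<noteq> p\<close> in the composant \<open>\<kappa>(p)\<close>, let
  \<open>C(x)\<close> be the union of all subcontinua of \<open>\<kappa>(p) \<setminus> {p}\<close> through \<open>x\<close>. By boundary bumping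
  \<open>p\<close> lies in the closure of \<open>C(x)\<close>, so \<open>C(x) \<union> {p}\<close> is connected. If some \<open>C(x)\<close> meets every
  \<open>U\<^sub>i\<close>, a finite union of subcontinua through \<open>x\<close> is as required. Otherwise let \<open>B\<^sub>i\<close> be the closure
  of the union of \<open>{p}\<close> and all \<open>C(x)\<close> that miss \<open>U\<^sub>i\<close>. Each \<open>B\<^sub>i\<close> is a subcontinuum containing
  \<open>p\<close>, proper because it misses \<open>U\<^sub>i \<setminus> {p}\<close>, and finitely many of them cover the dense set
  \<open>\<kappa>(p)\<close> and hence \<open>X\<close>, contradicting indecomposability.\<close>

section \<open>Subcontinua and boundary bumping\<close>

lemma subcontinuum_singleton: "x \<in> topspace X \<Longrightarrow> subcontinuum X {x}"
  by (simp add: subcontinuum_def)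

lemma subcontinuum_Un:
  assumes "subcontinuum X A" "subcontinuum X B" "A \<inter> B \<noteq> {}"
  shows "subcontinuum X (A \<union> B)"
  using assms by (simp add: subcontinuum_def compactin_Un connectedin_Un)

lemma subcontinuum_Union:
  assumes "finite \<K>" "\<K> \<noteq> {}" "\<And>K. K \<in> \<K> \<Longrightarrow> subcontinuum X K \<and> x \<in> K"
  shows "subcontinuum X (\<Union>\<K>)"
proof -
  have K: "compactin X K" "connectedin X K" "x \<in> K" if "K \<in> \<K>" for K
    using assms(3)[OF that] by (simp_all add: subcontinuum_def)
  have "x \<in> \<Inter>\<K>"
    using K(3) by blast
  then have "connectedin X (\<Union>\<K>)"
    using K(2) by (intro connectedin_Union) blast+
  moreover have "compactin X (\<Union>\<K>)"
    using K(1) assms(1) by (intro compactin_Union)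
  moreover have "\<Union>\<K> \<noteq> {}"
    using K(3) assms(2) by blast
  ultimately show ?thesis
    by (simp add: subcontinuum_def)
qed

text \<open>The component of \<open>x\<close> in the complement of \<open>W\<close> works: boundary
  bumping forces it to touch the frontier of that complement. The lemma is applied both to
  \<open>X\<close> and to a subcontinuum viewed as a space.\<close>

lemma subcontinuum_reaching_closure:
  assumes X: "compact_space X" "connected_space X" "Hausdorff_space X"
    and W: "openin X W" "W \<noteq> {}" and x: "x \<in> topspace X - W"
  obtains K where "subcontinuum X K" "x \<in> K" "K \<inter> W = {}" "K \<inter> X closure_of W \<noteq> {}"
proof -
  define S where "S = topspace X - W"
  have clS: "closedin X S" and ne: "S \<noteq> topspace X"
    using W openin_subset by (auto simp: S_def)
  define K where "K = connected_component_of_set (subtopology X S) x"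
  have xS: "x \<in> topspace (subtopology X S)"
    using x by (auto simp: S_def)
  have K: "K \<in> connected_components_of (subtopology X S)"
    using xS by (simp add: K_def connected_component_in_connected_components_of)
  have xK: "x \<in> K"
    using xS by (simp add: K_def connected_component_of_refl)
  have conK: "connectedin X K" "K \<subseteq> S"
    using connectedin_connected_components_of[OF K] by (auto simp: connectedin_subtopology)
  have "closedin X K"
    using closedin_trans_full[OF closedin_connected_components_of[OF K] clS] .
  then have "compactin X K"
    using X(1) closedin_compact_space by blast
  moreover have "K \<inter> X frontier_of S \<noteq> {}"
    using boundary_bumping_theorem_closed[OF X(2,1,3) clS ne K] .
  \<comment> \<open>The frontier of \<open>S\<close> lies in the closure of the complement of
    \<open>S\<close>, which is \<open>W\<close>.\<close>
  moreover have "X frontier_of S \<subseteq> X closure_of W"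
    using W openin_subset unfolding frontier_of_closures S_def
    by (metis Diff_Diff_Int Int_lower2 inf.absorb_iff2)
  ultimately show thesis
    using that[of K] xK conK by (auto simp: subcontinuum_def S_def)
qed

lemma open_nhd_closure_subset:
  assumes "compact_space X" "Hausdorff_space X" "openin X U" "q \<in> U"
  obtains W where "openin X W" "q \<in> W" "X closure_of W \<subseteq> U"
proof -
  have "regular_space X"
    using assms compact_Hausdorff_imp_regular_space by blast
  then obtain W V where "openin X W" "closedin X V" "q \<in> W" "W \<subseteq> V" "V \<subseteq> U"
    using assms unfolding neighbourhood_base_of_closedin[symmetric] neighbourhood_base_of by metis
  then show thesis
    using that closure_of_minimal by (metis order_trans)
qed

section \<open>Composants and punctured composants\<close>

lemma proper_subcontinuum_singleton:
  assumes "continuum X" "p \<in> topspace X"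
  shows "proper_subcontinuum X {p}"
proof -
  have "topspace X \<noteq> {p}"
    using assms(1) by (metis continuum_def singletonD)
  then show ?thesis
    using subcontinuum_singleton[OF assms(2)] by (auto simp: proper_subcontinuum_def)
qed

lemma mem_composant:
  assumes "continuum X" "p \<in> topspace X"
  shows "p \<in> composant X p"
  using proper_subcontinuum_singleton[OF assms] by (auto simp: composant_def)

lemma composant_subset_topspace: "composant X p \<subseteq> topspace X"
  by (auto simp: composant_def proper_subcontinuum_def subcontinuum_def
      dest: compactin_subset_topspace)

text \<open>If \<open>U\<close> omits \<open>p\<close>, shrink it to \<open>W\<close> with closure
  inside \<open>U\<close>. Bumping gives a subcontinuum through \<open>p\<close> that reaches this
  closure and is proper because it misses \<open>W\<close>.\<close>

lemma composant_dense:
  assumes X: "continuum X" and p: "p \<in> topspace X"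
  shows "X closure_of (composant X p) = topspace X"
proof -
  have "composant X p \<inter> U \<noteq> {}" if U: "openin X U" "U \<noteq> {}" for U
  proof (cases "p \<in> U")
    case True
    then show ?thesis
      using mem_composant[OF assms] by blast
  next
    case False
    obtain q where q: "q \<in> U"
      using U by blast
    then obtain W where W: "openin X W" "q \<in> W" "X closure_of W \<subseteq> U"
      using open_nhd_closure_subset U X unfolding continuum_def by metis
    have "W \<subseteq> U"
      using closure_of_subset[OF openin_subset[OF W(1)]] W(3) by blast
    then obtain K where K: "subcontinuum X K" "p \<in> K" "K \<inter> W = {}" "K \<inter> X closure_of W \<noteq> {}"
      using subcontinuum_reaching_closure[of X W p] X W p False unfolding continuum_def by blast
    have "K \<noteq> topspace X"
      using K(3) W(2) openin_subset[OF W(1)] by blast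
    then show ?thesis
      using K W(3) by (auto simp: composant_def proper_subcontinuum_def)
  qed
  then show ?thesis
    by (metis dense_intersects_open)
qed

text \<open>Bumping takes place inside a proper subcontinuum \<open>L\<close> containing
  \<open>p\<close> and \<open>x\<close>: what stays in \<open>L\<close> stays in the composant, and
  avoiding a neighbourhood \<open>W\<close> of \<open>p\<close> avoids \<open>p\<close>.\<close>

lemma subcontinuum_in_punctured_composant:
  assumes X: "continuum X" and x: "x \<in> composant X p - {p}"
    and V: "openin X V" "p \<in> V"
  obtains K where "subcontinuum X K" "K \<subseteq> composant X p - {p}" "x \<in> K" "K \<inter> V \<noteq> {}"
proof (cases "x \<in> V")
  case True
  have "subcontinuum X {x}"
    using V True openin_subset by (intro subcontinuum_singleton) blast
  then show thesis
    using that[of "{x}"] x True by auto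
next
  case False
  obtain L where L: "proper_subcontinuum X L" "p \<in> L" "x \<in> L"
    using x by (auto simp: composant_def)
  then have cL: "compactin X L" "connectedin X L"
    by (auto simp: proper_subcontinuum_def subcontinuum_def)
  have Lsub: "L \<subseteq> topspace X"
    using cL(1) compactin_subset_topspace by blast
  obtain W where W: "openin X W" "p \<in> W" "X closure_of W \<subseteq> V"
    using open_nhd_closure_subset V X unfolding continuum_def by metis
  have WV: "W \<subseteq> V"
    using closure_of_subset[OF openin_subset[OF W(1)]] W(3) by blast
  have L_space: "compact_space (subtopology X L)" "connected_space (subtopology X L)"
    "Hausdorff_space (subtopology X L)"
    using cL X Hausdorff_space_subtopology
    by (auto simp: compact_space_subtopology connectedin_def continuum_def)
  have op: "openin (subtopology X L) (L \<inter> W)"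
    using W(1) by (simp add: openin_subtopology_Int2)
  have ne: "L \<inter> W \<noteq> {}"
    using L(2) W(2) by blast
  have mem: "x \<in> topspace (subtopology X L) - L \<inter> W"
    using L(3) Lsub False WV by auto
  obtain K where K: "subcontinuum (subtopology X L) K" "x \<in> K" "K \<inter> (L \<inter> W) = {}"
    "K \<inter> subtopology X L closure_of (L \<inter> W) \<noteq> {}"
    using subcontinuum_reaching_closure[OF L_space op ne mem] by blast
  have KX: "subcontinuum X K" "K \<subseteq> L"
    using K(1) by (auto simp: subcontinuum_def compactin_subtopology connectedin_subtopology)
  have "subtopology X L closure_of (L \<inter> W) \<subseteq> X closure_of W"
    by (meson Int_lower2 closure_of_mono closure_of_subtopology_subset order_trans)
  then have "K \<inter> V \<noteq> {}"
    using K(4) W(3) by blast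
  moreover have "K \<subseteq> composant X p - {p}"
    using KX L K(3) W(2) by (auto simp: composant_def)
  ultimately show thesis
    using that KX K by blast
qed

section \<open>Finite unions in indecomposable continua, and pieces of the punctured
  composant\<close>

lemma indecomposable_finite_Union:
  assumes X: "continuum X" "indecomposable X" and p: "p \<in> topspace X"
    and "finite \<A>" "\<And>A. A \<in> \<A> \<Longrightarrow> proper_subcontinuum X A \<and> p \<in> A"
  shows "proper_subcontinuum X (\<Union>(insert {p} \<A>))"
  using assms(4,5)
proof (induction \<A> rule: finite_induct)
  \<comment> \<open>The inserted \<open>{p}\<close> makes the union over the empty family a proper
    subcontinuum.\<close>
  case empty
  then show ?case
    using proper_subcontinuum_singleton X p by simp
next
  case (insert A \<A>)
  let ?B = "\<Union>(insert {p} \<A>)"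
  have A: "proper_subcontinuum X A" "p \<in> A" and B: "proper_subcontinuum X ?B"
    using insert by auto
  have "A \<inter> ?B \<noteq> {}"
    using A by blast
  then have "subcontinuum X (A \<union> ?B)"
    using A B by (intro subcontinuum_Un) (auto simp: proper_subcontinuum_def)
  \<comment> \<open>Two proper subcontinua cannot cover an indecomposable continuum, so properness
    survives each step.\<close>
  moreover have "A \<union> ?B \<noteq> topspace X"
    using X(2) A B unfolding indecomposable_def by blast
  moreover have "\<Union>(insert {p} (insert A \<A>)) = A \<union> ?B"
    by blast
  ultimately show ?case
    by (simp add: proper_subcontinuum_def)
qed

text \<open>Subcontinua are used in place of the ordinary connected component so that any finitely
  many points of the piece lie in one compact connected subset of it.\<close>

definition punctured_composant_component :: "'a topology \<Rightarrow> 'a \<Rightarrow> 'a \<Rightarrow> 'a set" where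
  "punctured_composant_component X p x =
     \<Union>{K. subcontinuum X K \<and> K \<subseteq> composant X p - {p} \<and> x \<in> K}"

lemma mem_punctured_composant_component:
  assumes "x \<in> composant X p - {p}"
  shows "x \<in> punctured_composant_component X p x"
proof -
  have "x \<in> topspace X"
    using assms composant_subset_topspace[of X p] by blast
  then show ?thesis
    using assms subcontinuum_singleton[of x X] unfolding punctured_composant_component_def by blast
qed

text \<open>Subcontinua through \<open>x\<close> that avoid \<open>p\<close> enter every
  neighbourhood of \<open>p\<close>, so adding \<open>p\<close> stays within the closure of a
  connected set. The point \<open>p\<close> then links the pieces of different
  \<open>x\<close>.\<close>

lemma connectedin_insert_punctured_composant_component:
  assumes X: "continuum X" and p: "p \<in> topspace X" and x: "x \<in> composant X p - {p}"
  shows "connectedin X (insert p (punctured_composant_component X p x))"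
proof (rule connectedin_intermediate_closure_of)
  let ?C = "punctured_composant_component X p x"
  let ?\<K> = "{K. subcontinuum X K \<and> K \<subseteq> composant X p - {p} \<and> x \<in> K}"
  show "connectedin X ?C"
    unfolding punctured_composant_component_def
  proof (rule connectedin_Union)
    show "connectedin X K" if "K \<in> ?\<K>" for K
      using that by (simp add: subcontinuum_def)
    have "x \<in> \<Inter>?\<K>"
      by blast
    then show "\<Inter>?\<K> \<noteq> {}"
      by (metis empty_iff)
  qed
  have "\<exists>y\<in>?C. y \<in> V" if V: "p \<in> V" "openin X V" for V
  proof -
    obtain K where "subcontinuum X K" "K \<subseteq> composant X p - {p}" "x \<in> K" "K \<inter> V \<noteq> {}"
      using subcontinuum_in_punctured_composant[OF X x V(2,1)] .
    then show ?thesis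
      unfolding punctured_composant_component_def by blast
  qed
  then have "p \<in> X closure_of ?C"
    using p by (auto simp: in_closure_of)
  moreover have "?C \<subseteq> topspace X"
    using \<open>connectedin X ?C\<close> connectedin_subset_topspace by blast
  ultimately show "insert p ?C \<subseteq> X closure_of ?C"
    using closure_of_subset by blast
qed auto

lemma subcontinuum_meeting_all:
  assumes "finite \<U>" and x: "x \<in> composant X p - {p}"
    and meets: "\<And>U. U \<in> \<U> \<Longrightarrow> punctured_composant_component X p x \<inter> U \<noteq> {}"
  obtains K where "subcontinuum X K" "K \<subseteq> composant X p - {p}" "\<And>U. U \<in> \<U> \<Longrightarrow> K \<inter> U \<noteq> {}"
proof -
  have "\<exists>K. subcontinuum X K \<and> K \<subseteq> composant X p - {p} \<and> x \<in> K \<and> K \<inter> U \<noteq> {}"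
    if "U \<in> \<U>" for U
    using meets[OF that] unfolding punctured_composant_component_def by blast
  then obtain f where f: "\<And>U. U \<in> \<U> \<Longrightarrow> subcontinuum X (f U) \<and> f U \<subseteq> composant X p - {p} \<and>
      x \<in> f U \<and> f U \<inter> U \<noteq> {}"
    by metis
  have "x \<in> topspace X"
    using x composant_subset_topspace[of X p] by blast
  \<comment> \<open>The sets \<open>f U\<close> are glued at their common point \<open>x\<close>;
    \<open>{x}\<close> keeps the union nonempty when \<open>\<U>\<close> is empty.\<close>
  have "subcontinuum X K \<and> x \<in> K" if "K \<in> insert {x} (f ` \<U>)" for K
    using that f subcontinuum_singleton[OF \<open>x \<in> topspace X\<close>] by auto
  then have "subcontinuum X (\<Union>(insert {x} (f ` \<U>)))"
    using \<open>finite \<U>\<close> by (intro subcontinuum_Union[where x = x]) simp_all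
  moreover have "\<Union>(insert {x} (f ` \<U>)) \<subseteq> composant X p - {p}"
    using f x by blast
  moreover have "\<Union>(insert {x} (f ` \<U>)) \<inter> U \<noteq> {}" if "U \<in> \<U>" for U
    using f[OF that] that by blast
  ultimately show thesis
    using that by blast
qed

lemma proper_subcontinuum_closure_of_missing:
  assumes X: "continuum X" and p: "p \<in> topspace X" and U: "openin X U" "U \<noteq> {}"
    and A: "A = insert p (\<Union>{C. \<exists>x\<in>composant X p - {p}.
              C = punctured_composant_component X p x \<and> C \<inter> U = {}})"
  shows "proper_subcontinuum X (X closure_of A)"
proof -
  let ?\<C> = "{C. \<exists>x\<in>composant X p - {p}. C = punctured_composant_component X p x \<and> C \<inter> U = {}}"
  \<comment> \<open>Each piece is given its own copy of \<open>p\<close>, so that all members of the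
    family are connected and share a point; \<open>{p}\<close> covers the case of no pieces.\<close>
  have "connectedin X (\<Union>(insert {p} (insert p ` ?\<C>)))"
  proof (rule connectedin_Union)
    show "connectedin X S" if "S \<in> insert {p} (insert p ` ?\<C>)" for S
      using that p connectedin_insert_punctured_composant_component[OF X p] by auto
    have "p \<in> \<Inter>(insert {p} (insert p ` ?\<C>))"
      by blast
    then show "\<Inter>(insert {p} (insert p ` ?\<C>)) \<noteq> {}"
      by blast
  qed
  moreover have "\<Union>(insert {p} (insert p ` ?\<C>)) = A"
    unfolding A by blast
  ultimately have conA: "connectedin X A"
    by simp
  have "compactin X (X closure_of A)"
    using X by (simp add: closedin_compact_space continuum_def)
  moreover have "X closure_of A \<noteq> {}"
    using A closure_of_subset[OF connectedin_subset_topspace[OF conA]] by blast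
  moreover have "X closure_of A \<noteq> topspace X"
  \<comment> \<open>\<open>A\<close> contains \<open>p\<close>, which may lie in \<open>U\<close>,
    so only \<open>U - {p}\<close> is sure to be missed. Density would then give
    \<open>U = {p}\<close>, a clopen singleton in a connected space with more than one
    point.\<close>
  proof
    assume dense: "X closure_of A = topspace X"
    have "openin X (U - {p})"
      using X U(1) by (simp add: continuum_def open_in_Hausdorff_delete)
    moreover have "A \<inter> (U - {p}) = {}"
      unfolding A by blast
    ultimately have "U - {p} = {}"
      using dense by (metis dense_intersects_open)
    then have "openin X {p}"
      using U by (metis Diff_eq_empty_iff subset_singletonD)
    moreover have "closedin X {p}"
      using X p by (simp add: closedin_Hausdorff_singleton continuum_def)
    ultimately have "topspace X = {p}"
      using X by (metis connected_space_clopen_in continuum_def empty_not_insert)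
    then show False
      using X by (auto simp: continuum_def)
  qed
  ultimately show ?thesis
    using conA by (auto simp: proper_subcontinuum_def subcontinuum_def intro: connectedin_closure_of)
qed

theorem theorem3:
  fixes X :: "'a topology"
  assumes "continuum X" and "indecomposable X"
  shows "\<forall>p\<in>topspace X. proper_shore_point X p"
proof
  fix p
  assume p: "p \<in> topspace X"
  have "\<exists>K. subcontinuum X K \<and> K \<subseteq> composant X p - {p} \<and> (\<forall>U\<in>\<U>. K \<inter> U \<noteq> {})"
    if fin: "finite \<U>" and op: "\<forall>U\<in>\<U>. openin X U \<and> U \<noteq> {}" for \<U>
  proof (rule ccontr)
    assume none: "\<not> ?thesis"
    define A where "A U = insert p (\<Union>{C. \<exists>x\<in>composant X p - {p}.
        C = punctured_composant_component X p x \<and> C \<inter> U = {}})" for U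
    have proper_A: "proper_subcontinuum X (X closure_of A U)" if "U \<in> \<U>" for U
      using proper_subcontinuum_closure_of_missing[OF assms(1) p _ _ A_def] op that by blast
    have sub: "A U \<subseteq> topspace X" for U
      using p composant_subset_topspace[of X p]
      unfolding A_def punctured_composant_component_def by blast
    have "p \<in> X closure_of A U" for U
      using closure_of_subset[OF sub] by (auto simp: A_def)
    \<comment> \<open>Here indecomposability enters: the finitely many closures, all through
      \<open>p\<close>, still have a proper union.\<close>
    then have proper: "proper_subcontinuum X (\<Union>(insert {p} ((\<lambda>U. X closure_of A U) ` \<U>)))"
      (is "proper_subcontinuum X ?B")
      using proper_A fin by (intro indecomposable_finite_Union[OF assms p]) auto
    have "x \<in> ?B" if x: "x \<in> composant X p" for x
    proof (cases "x = p")
      case False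
      with x have x: "x \<in> composant X p - {p}"
        by blast
      \<comment> \<open>A piece meeting every member of \<open>\<U>\<close> would yield a
        subcontinuum excluded by \<open>none\<close>.\<close>
      obtain U where U: "U \<in> \<U>" "punctured_composant_component X p x \<inter> U = {}"
        using subcontinuum_meeting_all[OF fin x] none by metis
      then have "x \<in> A U"
        using x mem_punctured_composant_component[OF x] unfolding A_def by blast
      then show ?thesis
        using U(1) closure_of_subset[OF sub] by blast
    qed auto
    moreover have "closedin X ?B"
      using proper assms(1) compactin_imp_closedin
      unfolding proper_subcontinuum_def subcontinuum_def continuum_def by blast
    \<comment> \<open>The closed set \<open>?B\<close> contains the dense composant, so it is the
      whole space, although it is proper.\<close>
    ultimately have "X closure_of (composant X p) \<subseteq> ?B"
      by (meson closure_of_minimal subsetI)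
    then have "?B = topspace X"
      using composant_dense[OF assms(1) p] closedin_subset[OF \<open>closedin X ?B\<close>]
      by (metis subset_antisym)
    then show False
      using proper by (simp add: proper_subcontinuum_def)
  qed
  then show "proper_shore_point X p"
    using p by (simp add: proper_shore_point_def)
qed

end
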